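(* Let $\hat g\in\{A_{2n-1}^{(2)},B_n^{(1)},D_n^{(1)}\}$, $1\le p\le n$ and $N\ge1$. Then the transfer matrix has the "right" $Z_2$ symmetry $$[\mathcal Z^{(r)},t(u,p)]=0,$$ where $\mathcal Z^{(r)}=Z^{(r)}_1Z_2^{(r)}\cdots Z_N^{(r)}$ (so $(\mathcal Z^{(r)})^2=\mathbb I^{\otimes N}$) and $Z^{(r)}$ is the $d\times d$ matrix $$Z^{(r)}=\begin{pmatrix}0&0&1\\0&\mathbb I_{(d-2)\times(d-2)}&0\\1&0&0\end{pmatrix}.$$
   Context: **R-matrix.** Fix $n\ge1$, $\eta\in\mathbb C$ and a type $\hat g\in\{A_{2n-1}^{(2)},B_n^{(1)},D_n^{(1)}\}$. Set $d=2n+1$ for $B_n^{(1)}$ and $d=2n$ for $A_{2n-1}^{(2)},D_n^{(1)}$; $\mathcal V=\mathbb C^d$; $e_{ij}$ the elementary $d\times d$ matrices; $\mathbb I$ the identity on $\mathcal V$. Let $\kappa=2n,\ 2n-1,\ 2n-2$ for $A_{2n-1}^{(2)},B_n^{(1)},D_n^{(1)}$ respectively. Let $h=\cosh$, $\sigma=-1$ for $A_{2n-1}^{(2)}$ and $h=\sinh$, $\sigma=+1$ for $B_n^{(1)},D_n^{(1)}$. Put $\alpha'=d+1-\alpha$. For $A_{2n-1}^{(2)}$: $\epsilon_\alpha=1$, $\bar\alpha=\alpha-\frac12$ if $\alpha\le n$; $\epsilon_\alpha=-1$, $\bar\alpha=\alpha+\frac12$ if $\alpha\ge n+1$. For $B_n^{(1)},D_n^{(1)}$: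 $\epsilon_\alpha=1$ and $\bar\alpha=\alpha+\frac12,\ \alpha,\ \alpha-\frac12$ according as $\alpha<\frac{d+1}2$, $\alpha=\frac{d+1}2$, $\alpha>\frac{d+1}2$. Let $$c(u)=2\sinh(\tfrac u2-2\eta)h(\tfrac u2-\kappa\eta),\ b(u)=2\sinh(\tfrac u2)h(\tfrac u2-\kappa\eta),\ e(u)=-2e^{-u/2}\sinh(2\eta)h(\tfrac u2-\kappa\eta),\ \bar e(u)=e^ue(u),$$ and $a_{\alpha\beta}(u)$ equal to: $2\sinh(\frac u2)h(\frac u2-(\kappa-2)\eta)$ if $\alpha=\beta\ne\alpha'$; $b(u)+2\sinh(2\eta)\sinh((2n-1)\eta)$ if $\alpha=\beta=\alpha'$ (only for $B_n^{(1)}$); $2\sinh(2\eta)e^{-u/2}[\sigma\epsilon_\alpha\epsilon_\beta e^{(\kappa+2(\bar\alpha-\bar\beta))\eta}\sinh(\frac u2)-\delta_{\alpha\beta'}h(\frac u2-\kappa\eta)]$ if $\alpha<\beta$; $2\sinh(2\eta)e^{u/2}[\epsilon_\alpha\epsilon_\beta e^{(-\kappa+2(\bar\alpha-\bar\beta))\eta}\sinh(\frac u2)-\delta_{\alpha\beta'}h(\frac u2-\kappa\eta)]$ if $\alpha>\beta$. Then $$R(u)=c(u)\sum_{\alpha\ne\alpha'}e_{\alpha\alpha}\otimes e_{\alpha\alpha}+b(u)\sum_{\alpha\neq\beta,\beta'}e_{\alpha\alpha}\otimes e_{\beta\beta}+\Big(e(u)\sum_{\alpha<\beta,\alpha\ne\beta'}+\bar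 e(u)\sum_{\alpha>\beta,\alpha\ne\beta'}\Big)e_{\alpha\beta}\otimes e_{\beta\alpha}+\sum_{\alpha,\beta}a_{\alpha\beta}(u)e_{\alpha\beta}\otimes e_{\alpha'\beta'}.$$ Subscripts on operators indicate the tensor factors on which they act; $R_{21}=\mathcal PR_{12}\mathcal P$ with $\mathcal P$ the permutation. **K-matrices.** $\rho=-2\kappa\eta-i\pi$ for $A_{2n-1}^{(2)}$, $\rho=-2\kappa\eta$ for $B_n^{(1)},D_n^{(1)}$. Fix $\gamma_0\in\{1,-1\}$; $\gamma=\gamma_0e^{(4p-2)\eta+\rho/2}$. $K^R(u,p)$ is diagonal with first $p$ entries $e^{-u}$, middle $d-2p$ entries $\frac{\gamma e^u+1}{\gamma+e^u}$, last $p$ entries $e^u$. $M=\varsigma\sum_\alpha e^{4(\frac{d+1}2-\bar\alpha)\eta}e_{\alpha\alpha}$ with $\varsigma=-1$ for $A_{2n-1}^{(2)}$, $\varsigma=1$ for $B_n^{(1)},D_n^{(1)}$; $K^L(u,p)=K^R(-u-\rho,p)M$. Identities in $u$ are understood as identities of meromorphic functions. **Transfer matrix** (on $\mathcal V^{\otimes N}$, $a$ an auxiliary copy of $\mathcal V$): $t(u,p)=\operatorname{tr}_aK^L_a(u,p)T_a(u)K^R_a(u,p)\widehat T_a(u)$, $T_a(u)=R_{aN}(u)\cdots R_{a1}(u)$, $\widehat T_a(u)=R_{1a}(u)\cdots R_{Na}(u)$. *)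

theory Defs
  imports Complex_Main "Jordan_Normal_Form.Matrix"
begin

section \<open>Matrices and operators on tensor powers\<close>

definition mat_sum :: "nat \<Rightarrow> ('i \<Rightarrow> complex mat) \<Rightarrow> 'i set \<Rightarrow> complex mat" where
  "mat_sum m F I = mat m m (\<lambda>rc. \<Sum>i\<in>I. F i $$ rc)"

text \<open>Rows and columns of matrices are numbered from 0 by the library; the labels \<open>\<alpha>, \<beta>\<close> below run
  over \<open>1, \<dots>, d\<close>.\<close>

definition elem_mat :: "nat \<Rightarrow> nat \<Rightarrow> nat \<Rightarrow> complex mat" where
  "elem_mat d \<alpha> \<beta> = mat d d (\<lambda>(i, j). if i + 1 = \<alpha> \<and> j + 1 = \<beta> then 1 else 0)"

definition kron :: "complex mat \<Rightarrow> complex mat \<Rightarrow> complex mat" (infixl \<open>\<otimes>\<^sub>k\<close> 75) where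
  "A \<otimes>\<^sub>k B = mat (dim_row A * dim_row B) (dim_col A * dim_col B)
     (\<lambda>(i, j). A $$ (i div dim_row B, j div dim_col B) * B $$ (i mod dim_row B, j mod dim_col B))"

text \<open>Basis vectors of \<open>(\<complex>\<^sup>d)\<^sup>\<otimes>\<^sup>L\<close> are numbered \<open>x < d ^ L\<close>, where \<open>x\<close> encodes its \<open>L\<close> tensor labels
  (each \<open>< d\<close>) in base \<open>d\<close>, factor \<open>0\<close> being the most significant digit. This agrees with
  \<open>\<otimes>\<^sub>k\<close>. The factors are \<open>0, \<dots>, L - 1\<close>.\<close>

definition digit :: "nat \<Rightarrow> nat \<Rightarrow> nat \<Rightarrow> nat \<Rightarrow> nat" where
  "digit d L x i = (x div d ^ (L - 1 - i)) mod d"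

text \<open>\<open>op1 d L i A\<close> is \<open>A\<close> acting on factor \<open>i\<close>. In \<open>op2 d L i j A\<close> the first tensor leg of the
  \<open>d\<^sup>2 \<times> d\<^sup>2\<close> matrix \<open>A\<close> acts on factor \<open>i\<close> and the second leg on factor \<open>j\<close>; \<open>i > j\<close> is allowed,
  and then it is the conjugate of \<open>op2 d L j i A\<close> by the permutation of the two factors.\<close>

definition op1 :: "nat \<Rightarrow> nat \<Rightarrow> nat \<Rightarrow> complex mat \<Rightarrow> complex mat" where
  "op1 d L i A = mat (d ^ L) (d ^ L) (\<lambda>(r, s).
     if \<forall>k<L. k \<noteq> i \<longrightarrow> digit d L r k = digit d L s k
     then A $$ (digit d L r i, digit d L s i) else 0)"

definition op2 :: "nat \<Rightarrow> nat \<Rightarrow> nat \<Rightarrow> nat \<Rightarrow> complex mat \<Rightarrow> complex mat" where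
  "op2 d L i j A = mat (d ^ L) (d ^ L) (\<lambda>(r, s).
     if \<forall>k<L. k \<noteq> i \<and> k \<noteq> j \<longrightarrow> digit d L r k = digit d L s k
     then A $$ (digit d L r i * d + digit d L r j, digit d L s i * d + digit d L s j) else 0)"

definition mat_prod :: "nat \<Rightarrow> complex mat list \<Rightarrow> complex mat" where
  "mat_prod m As = foldr (*) As (1\<^sub>m m)"

text \<open>Partial trace over factor \<open>0\<close> of \<open>(\<complex>\<^sup>d)\<^sup>\<otimes>\<^sup>(\<^sup>N\<^sup>+\<^sup>1\<^sup>)\<close>.\<close>

definition ptrace0 :: "nat \<Rightarrow> nat \<Rightarrow> complex mat \<Rightarrow> complex mat" where
  "ptrace0 d N X = mat (d ^ N) (d ^ N) (\<lambda>(r, s). \<Sum>k<d. X $$ (k * d ^ N + r, k * d ^ N + s))"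

definition commutator :: "complex mat \<Rightarrow> complex mat \<Rightarrow> complex mat" where
  "commutator A B = A * B - B * A"

section \<open>The R-matrix\<close>

text \<open>\<open>A2\<close>, \<open>B1\<close>, \<open>D1\<close> stand for \<open>A\<^sub>2\<^sub>n\<^sub>-\<^sub>1\<^sup>(\<^sup>2\<^sup>)\<close>, \<open>B\<^sub>n\<^sup>(\<^sup>1\<^sup>)\<close>, \<open>D\<^sub>n\<^sup>(\<^sup>1\<^sup>)\<close>.\<close>

datatype affine_type = A2 | B1 | D1

definition dimV :: "affine_type \<Rightarrow> nat \<Rightarrow> nat" where
  "dimV g n = (case g of A2 \<Rightarrow> 2 * n | B1 \<Rightarrow> 2 * n + 1 | D1 \<Rightarrow> 2 * n)"

definition kap :: "affine_type \<Rightarrow> nat \<Rightarrow> complex" where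
  "kap g n = (case g of A2 \<Rightarrow> 2 * of_nat n | B1 \<Rightarrow> 2 * of_nat n - 1 | D1 \<Rightarrow> 2 * of_nat n - 2)"

definition hfun :: "affine_type \<Rightarrow> complex \<Rightarrow> complex" where
  "hfun g = (case g of A2 \<Rightarrow> cosh | B1 \<Rightarrow> sinh | D1 \<Rightarrow> sinh)"

definition sig :: "affine_type \<Rightarrow> complex" where
  "sig g = (case g of A2 \<Rightarrow> -1 | B1 \<Rightarrow> 1 | D1 \<Rightarrow> 1)"

definition conj_ix :: "nat \<Rightarrow> nat \<Rightarrow> nat" where
  "conj_ix d \<alpha> = d + 1 - \<alpha>"

definition eps :: "affine_type \<Rightarrow> nat \<Rightarrow> nat \<Rightarrow> complex" where
  "eps g n \<alpha> = (if g = A2 \<and> \<alpha> > n then -1 else 1)"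

definition bar :: "affine_type \<Rightarrow> nat \<Rightarrow> nat \<Rightarrow> complex" where
  "bar g n \<alpha> =
     (if g = A2 then (if \<alpha> \<le> n then of_nat \<alpha> - 1/2 else of_nat \<alpha> + 1/2)
      else if 2 * \<alpha> < dimV g n + 1 then of_nat \<alpha> + 1/2
      else if 2 * \<alpha> = dimV g n + 1 then of_nat \<alpha>
      else of_nat \<alpha> - 1/2)"

definition c_coeff :: "affine_type \<Rightarrow> nat \<Rightarrow> complex \<Rightarrow> complex \<Rightarrow> complex" where
  "c_coeff g n \<eta> u = 2 * sinh (u/2 - 2 * \<eta>) * hfun g (u/2 - kap g n * \<eta>)"

definition b_coeff :: "affine_type \<Rightarrow> nat \<Rightarrow> complex \<Rightarrow> complex \<Rightarrow> complex" where
  "b_coeff g n \<eta> u = 2 * sinh (u/2) * hfun g (u/2 - kap g n * \<eta>)"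

definition e_coeff :: "affine_type \<Rightarrow> nat \<Rightarrow> complex \<Rightarrow> complex \<Rightarrow> complex" where
  "e_coeff g n \<eta> u = - 2 * exp (- u/2) * sinh (2 * \<eta>) * hfun g (u/2 - kap g n * \<eta>)"

definition ebar_coeff :: "affine_type \<Rightarrow> nat \<Rightarrow> complex \<Rightarrow> complex \<Rightarrow> complex" where
  "ebar_coeff g n \<eta> u = exp u * e_coeff g n \<eta> u"

definition a_coeff :: "affine_type \<Rightarrow> nat \<Rightarrow> complex \<Rightarrow> nat \<Rightarrow> nat \<Rightarrow> complex \<Rightarrow> complex" where
  "a_coeff g n \<eta> \<alpha> \<beta> u =
    (let \<kappa> = kap g n; \<delta> = (if \<alpha> = conj_ix (dimV g n) \<beta> then 1 else 0) in
     if \<alpha> = \<beta> then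
       (if \<alpha> \<noteq> conj_ix (dimV g n) \<alpha> then 2 * sinh (u/2) * hfun g (u/2 - (\<kappa> - 2) * \<eta>)
        else b_coeff g n \<eta> u + 2 * sinh (2 * \<eta>) * sinh ((2 * of_nat n - 1) * \<eta>))
     else if \<alpha> < \<beta> then
       2 * sinh (2 * \<eta>) * exp (- u/2) *
         (sig g * eps g n \<alpha> * eps g n \<beta> * exp ((\<kappa> + 2 * (bar g n \<alpha> - bar g n \<beta>)) * \<eta>) * sinh (u/2)
          - \<delta> * hfun g (u/2 - \<kappa> * \<eta>))
     else
       2 * sinh (2 * \<eta>) * exp (u/2) *
         (eps g n \<alpha> * eps g n \<beta> * exp ((- \<kappa> + 2 * (bar g n \<alpha> - bar g n \<beta>)) * \<eta>) * sinh (u/2)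
          - \<delta> * hfun g (u/2 - \<kappa> * \<eta>)))"

definition R_mat :: "affine_type \<Rightarrow> nat \<Rightarrow> complex \<Rightarrow> complex \<Rightarrow> complex mat" where
  "R_mat g n \<eta> u =
    (let d = dimV g n; E = elem_mat d; cj = conj_ix d; D = d * d in
       c_coeff g n \<eta> u \<cdot>\<^sub>m
         mat_sum D (\<lambda>\<alpha>. E \<alpha> \<alpha> \<otimes>\<^sub>k E \<alpha> \<alpha>) {\<alpha> \<in> {1..d}. \<alpha> \<noteq> cj \<alpha>}
     + b_coeff g n \<eta> u \<cdot>\<^sub>m
         mat_sum D (\<lambda>(\<alpha>, \<beta>). E \<alpha> \<alpha> \<otimes>\<^sub>k E \<beta> \<beta>) {(\<alpha>, \<beta>) \<in> {1..d} \<times> {1..d}. \<alpha> \<noteq> \<beta> \<and> \<alpha> \<noteq> cj \<beta>}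
     + (e_coeff g n \<eta> u \<cdot>\<^sub>m
          mat_sum D (\<lambda>(\<alpha>, \<beta>). E \<alpha> \<beta> \<otimes>\<^sub>k E \<beta> \<alpha>) {(\<alpha>, \<beta>) \<in> {1..d} \<times> {1..d}. \<alpha> < \<beta> \<and> \<alpha> \<noteq> cj \<beta>}
        + ebar_coeff g n \<eta> u \<cdot>\<^sub>m
          mat_sum D (\<lambda>(\<alpha>, \<beta>). E \<alpha> \<beta> \<otimes>\<^sub>k E \<beta> \<alpha>) {(\<alpha>, \<beta>) \<in> {1..d} \<times> {1..d}. \<alpha> > \<beta> \<and> \<alpha> \<noteq> cj \<beta>})
     + mat_sum D (\<lambda>(\<alpha>, \<beta>). a_coeff g n \<eta> \<alpha> \<beta> u \<cdot>\<^sub>m (E \<alpha> \<beta> \<otimes>\<^sub>k E (cj \<alpha>) (cj \<beta>))) ({1..d} \<times> {1..d}))"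

section \<open>The K-matrices\<close>

definition rho :: "affine_type \<Rightarrow> nat \<Rightarrow> complex \<Rightarrow> complex" where
  "rho g n \<eta> = - 2 * kap g n * \<eta> - (if g = A2 then \<i> * complex_of_real pi else 0)"

definition gam :: "affine_type \<Rightarrow> nat \<Rightarrow> complex \<Rightarrow> complex \<Rightarrow> nat \<Rightarrow> complex" where
  "gam g n \<eta> \<gamma>0 p = \<gamma>0 * exp ((4 * of_nat p - 2) * \<eta> + rho g n \<eta> / 2)"

definition KR :: "affine_type \<Rightarrow> nat \<Rightarrow> complex \<Rightarrow> complex \<Rightarrow> nat \<Rightarrow> complex \<Rightarrow> complex mat" where
  "KR g n \<eta> \<gamma>0 p u =
    (let d = dimV g n; \<gamma> = gam g n \<eta> \<gamma>0 p in
     mat d d (\<lambda>(i, j).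
       if i \<noteq> j then 0
       else if i < p then exp (- u)
       else if i < d - p then (\<gamma> * exp u + 1) / (\<gamma> + exp u)
       else exp u))"

text \<open>The points \<open>u\<close> at which the entries of \<open>KR\<close> are given by their defining formula, i.e.\ without
  division by zero. The middle block is absent if \<open>2 * p = dimV g n\<close>.\<close>

definition KR_defined :: "affine_type \<Rightarrow> nat \<Rightarrow> complex \<Rightarrow> complex \<Rightarrow> nat \<Rightarrow> complex \<Rightarrow> bool" where
  "KR_defined g n \<eta> \<gamma>0 p u \<longleftrightarrow> (2 * p < dimV g n \<longrightarrow> gam g n \<eta> \<gamma>0 p + exp u \<noteq> 0)"

definition M_mat :: "affine_type \<Rightarrow> nat \<Rightarrow> complex \<Rightarrow> complex mat" where
  "M_mat g n \<eta> =
    (let d = dimV g n in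
     (if g = A2 then -1 else 1) \<cdot>\<^sub>m
       mat_sum d (\<lambda>\<alpha>. exp (4 * ((of_nat d + 1) / 2 - bar g n \<alpha>) * \<eta>) \<cdot>\<^sub>m elem_mat d \<alpha> \<alpha>) {1..d})"

definition KL :: "affine_type \<Rightarrow> nat \<Rightarrow> complex \<Rightarrow> complex \<Rightarrow> nat \<Rightarrow> complex \<Rightarrow> complex mat" where
  "KL g n \<eta> \<gamma>0 p u = KR g n \<eta> \<gamma>0 p (- u - rho g n \<eta>) * M_mat g n \<eta>"

definition KL_defined :: "affine_type \<Rightarrow> nat \<Rightarrow> complex \<Rightarrow> complex \<Rightarrow> nat \<Rightarrow> complex \<Rightarrow> bool" where
  "KL_defined g n \<eta> \<gamma>0 p u \<longleftrightarrow> KR_defined g n \<eta> \<gamma>0 p (- u - rho g n \<eta>)"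

section \<open>The transfer matrix\<close>

text \<open>On \<open>V\<^sub>a \<otimes> V\<^sub>1 \<otimes> \<dots> \<otimes> V\<^sub>N\<close> the auxiliary space is factor \<open>0\<close> and site \<open>k\<close> is factor \<open>k\<close>.\<close>

definition mono_T :: "affine_type \<Rightarrow> nat \<Rightarrow> complex \<Rightarrow> nat \<Rightarrow> complex \<Rightarrow> complex mat" where
  "mono_T g n \<eta> N u =
    (let d = dimV g n in
     mat_prod (d ^ (N + 1)) (map (\<lambda>k. op2 d (N + 1) 0 k (R_mat g n \<eta> u)) (rev [1..<N + 1])))"

definition mono_That :: "affine_type \<Rightarrow> nat \<Rightarrow> complex \<Rightarrow> nat \<Rightarrow> complex \<Rightarrow> complex mat" where
  "mono_That g n \<eta> N u =
    (let d = dimV g n in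
     mat_prod (d ^ (N + 1)) (map (\<lambda>k. op2 d (N + 1) k 0 (R_mat g n \<eta> u)) [1..<N + 1]))"

definition transfer ::
  "affine_type \<Rightarrow> nat \<Rightarrow> complex \<Rightarrow> complex \<Rightarrow> nat \<Rightarrow> nat \<Rightarrow> complex \<Rightarrow> complex mat" where
  "transfer g n \<eta> \<gamma>0 N p u =
    (let d = dimV g n in
     ptrace0 d N (op1 d (N + 1) 0 (KL g n \<eta> \<gamma>0 p u) * mono_T g n \<eta> N u
                  * op1 d (N + 1) 0 (KR g n \<eta> \<gamma>0 p u) * mono_That g n \<eta> N u))"

section \<open>The right \<open>Z\<^sub>2\<close> operator\<close>

definition Zr :: "nat \<Rightarrow> complex mat" where
  "Zr d = mat d d (\<lambda>(i, j).
     if (i = 0 \<and> j = d - 1) \<or> (i = d - 1 \<and> j = 0) \<or> (i = j \<and> 0 < i \<and> i < d - 1) then 1 else 0)"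

text \<open>On \<open>V\<^sub>1 \<otimes> \<dots> \<otimes> V\<^sub>N\<close>, without the auxiliary space, the sites are the factors \<open>0, \<dots>, N - 1\<close>.\<close>

definition Zr_all :: "nat \<Rightarrow> nat \<Rightarrow> complex mat" where
  "Zr_all d N = mat_prod (d ^ N) (map (\<lambda>k. op1 d N k (Zr d)) [0..<N])"

end

theory Submission
  imports Defs
begin

text \<open>Let \<open>B(u) = diag(e\<^sup>u, 1, \<dots>, 1, e\<^sup>-\<^sup>u)\<close> and \<open>W(u) = Z\<^sup>(\<^sup>r\<^sup>) B(u)\<close>, which is \<open>Z\<^sup>(\<^sup>r\<^sup>)\<close> conjugated by the gauge
  transformation \<open>diag(e\<^sup>u\<^sup>/\<^sup>2, 1, \<dots>, 1, e\<^sup>-\<^sup>u\<^sup>/\<^sup>2)\<close>. A direct inspection of the coefficients shows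
  \<open>[R\<^sub>1\<^sub>2(u), W\<^sub>1(u) Z\<^sub>2\<^sup>(\<^sup>r\<^sup>)] = 0\<close>; by charge conservation of \<open>R\<close> also \<open>[R\<^sub>1\<^sub>2(u), Z\<^sub>1\<^sup>(\<^sup>r\<^sup>) W\<^sub>2(-u)] = 0\<close>.
  The first and last entries of the K-matrices are such that \<open>W(u) K\<^sup>R(u) = K\<^sup>R(u) W(-u)\<close> and
  \<open>W(-u) K\<^sup>L(u) = K\<^sup>L(u) W(u)\<close>. Hence the operator under the trace commutes with \<open>W\<^sub>a(-u) \<Z>\<^sup>(\<^sup>r\<^sup>)\<close>, and
  the trace over \<open>a\<close> commutes with \<open>\<Z>\<^sup>(\<^sup>r\<^sup>)\<close>. Neither the Yang-Baxter nor the reflection equation is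
  needed.\<close>

section \<open>Digit expansions\<close>

text \<open>Horner's scheme: label \<open>f 0\<close> becomes the most significant digit, matching
  \<open>digit\<close>, and the last factor is peeled off first, which suits induction on
  \<open>L\<close>.\<close>

primrec undigit :: "nat \<Rightarrow> nat \<Rightarrow> (nat \<Rightarrow> nat) \<Rightarrow> nat" where
  "undigit d 0 f = 0"
| "undigit d (Suc L) f = undigit d L f * d + f L"

lemma digit_less: "d > 0 \<Longrightarrow> digit d L x i < d"
  by (simp add: digit_def)

lemma digit_Suc_less: "i < L \<Longrightarrow> digit d (Suc L) x i = digit d L (x div d) i"
proof -
  assume "i < L"
  then have "L - i = Suc (L - 1 - i)" by simp
  then show ?thesis by (simp add: digit_def div_mult2_eq)
qed

lemma digit_Suc_last: "digit d (Suc L) x L = x mod d"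
  by (simp add: digit_def)

lemma undigit_less: "(\<And>i. i < L \<Longrightarrow> f i < d) \<Longrightarrow> undigit d L f < d ^ L"
proof (induction L)
  case (Suc L)
  then have "undigit d L f + 1 \<le> d ^ L" "f L < d" by (auto simp: Suc_leI)
  then have "undigit d L f * d + d \<le> d ^ L * d" "f L < d"
    using mult_le_mono1[of "undigit d L f + 1" "d ^ L" d] by (auto simp: algebra_simps)
  then show ?case by (simp add: mult.commute)
qed simp

lemma digit_undigit:
  "(\<And>i. i < L \<Longrightarrow> f i < d) \<Longrightarrow> i < L \<Longrightarrow> digit d L (undigit d L f) i = f i"
proof (induction L)
  case (Suc L)
  from Suc.prems have "f L < d" by simp
  then have "(undigit d L f * d + f L) div d = undigit d L f" by simp
  with \<open>f L < d\<close> Suc show ?case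
    by (cases "i < L") (auto simp: digit_Suc_less digit_Suc_last less_Suc_eq)
qed simp

lemma digit_eqI:
  "x < d ^ L \<Longrightarrow> y < d ^ L \<Longrightarrow> (\<And>i. i < L \<Longrightarrow> digit d L x i = digit d L y i) \<Longrightarrow> x = y"
proof (induction L arbitrary: x y)
  case (Suc L)
  have "x div d < d ^ L" "y div d < d ^ L"
    using Suc.prems(1,2) by (auto simp: less_mult_imp_div_less mult.commute)
  moreover have "digit d L (x div d) i = digit d L (y div d) i" if "i < L" for i
    using Suc.prems(3)[of i] that by (simp add: digit_Suc_less)
  ultimately have "x div d = y div d" by (rule Suc.IH)
  moreover have "x mod d = y mod d"
    using Suc.prems(3)[of L] by (simp add: digit_Suc_last)
  ultimately show ?case by (metis div_mult_mod_eq)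
qed simp

section \<open>Indices with the auxiliary factor in front\<close>

lemma digit_block_0: "k < d \<Longrightarrow> r < d ^ N \<Longrightarrow> digit d (Suc N) (k * d ^ N + r) 0 = k"
  by (simp add: digit_def)

lemma digit_block_Suc:
  assumes "i < N"
  shows "digit d (Suc N) (k * d ^ N + r) (Suc i) = digit d N r i"
proof -
  define e where "e = N - 1 - i"
  have N: "N = e + Suc i" and e: "N - Suc i = e" using assms by (simp_all add: e_def)
  \<comment> \<open>Since \<open>N > e\<close>, a factor \<open>d\<close> survives the division by
    \<open>d ^ e\<close>, so the leading block disappears modulo \<open>d\<close>.\<close>
  have split: "k * d ^ N = d ^ e * (k * d ^ i * d)"
    by (simp add: N power_add)
  show ?thesis
  proof (cases "d = 0")
    case False
    then have "(k * d ^ N + r) div d ^ e = k * d ^ i * d + r div d ^ e"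
      unfolding split by simp
    then show ?thesis
      by (simp add: digit_def e)
  qed (use assms in \<open>simp add: digit_def zero_power\<close>)
qed

lemma block_less:
  fixes k d m r :: nat
  assumes "k < d" "r < m"
  shows "k * m + r < d * m"
proof -
  have "k * m + r < (k + 1) * m" using assms by simp
  also have "\<dots> \<le> d * m" using assms by (intro mult_le_mono1) simp
  finally show ?thesis .
qed

text \<open>The map \<open>t i\<close> may depend on the factor, so that partial products of
  one-site permutations have this form too.\<close>

definition digit_map :: "nat \<Rightarrow> nat \<Rightarrow> (nat \<Rightarrow> nat \<Rightarrow> nat) \<Rightarrow> nat \<Rightarrow> nat" where
  "digit_map d L t x = undigit d L (\<lambda>i. t i (digit d L x i))"

lemma digit_map_less:
  "(\<And>i c. c < d \<Longrightarrow> t i c < d) \<Longrightarrow> d > 0 \<Longrightarrow> digit_map d L t x < d ^ L"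
  unfolding digit_map_def by (rule undigit_less) (simp add: digit_less)

lemma digit_digit_map:
  "(\<And>i c. c < d \<Longrightarrow> t i c < d) \<Longrightarrow> d > 0 \<Longrightarrow> i < L \<Longrightarrow>
    digit d L (digit_map d L t x) i = t i (digit d L x i)"
  unfolding digit_map_def by (rule digit_undigit) (simp_all add: digit_less)

section \<open>Swapping the extreme labels\<close>

definition swap_ends :: "nat \<Rightarrow> nat \<Rightarrow> nat" where
  "swap_ends d i = (if i = 0 then d - 1 else if i = d - 1 then 0 else i)"

lemma swap_ends_less [simp]: "i < d \<Longrightarrow> swap_ends d i < d"
  by (auto simp: swap_ends_def)

lemma swap_ends_swap_ends [simp]: "i < d \<Longrightarrow> swap_ends d (swap_ends d i) = i"
  by (auto simp: swap_ends_def)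

lemma swap_ends_eq_iff: "i < d \<Longrightarrow> j < d \<Longrightarrow> swap_ends d i = swap_ends d j \<longleftrightarrow> i = j"
  by (metis swap_ends_swap_ends)

text \<open>The permutation of basis vectors underlying \<open>Zr_all\<close>; on
  \<open>Suc N\<close> factors it moves the auxiliary label as well.\<close>

definition flip :: "nat \<Rightarrow> nat \<Rightarrow> nat \<Rightarrow> nat" where
  "flip d L = digit_map d L (\<lambda>i. swap_ends d)"

context
  fixes d :: nat
  assumes d_pos: "d > 0"
begin

lemma flip_less: "flip d L x < d ^ L"
  unfolding flip_def by (rule digit_map_less) (use d_pos in auto)

lemma digit_flip: "i < L \<Longrightarrow> digit d L (flip d L x) i = swap_ends d (digit d L x i)"
  unfolding flip_def by (rule digit_digit_map) (use d_pos in auto)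

lemma flip_flip: "x < d ^ L \<Longrightarrow> flip d L (flip d L x) = x"
  by (rule digit_eqI) (auto simp: flip_less digit_flip digit_less d_pos)

text \<open>Separates the auxiliary label from the site labels in the index layout used by
  \<open>ptrace0\<close>.\<close>

lemma flip_block:
  assumes "k < d" "r < d ^ N"
  shows "flip d (Suc N) (k * d ^ N + r) = swap_ends d k * d ^ N + flip d N r"
proof (rule digit_eqI)
  show "swap_ends d k * d ^ N + flip d N r < d ^ Suc N"
    using block_less[of "swap_ends d k" d "flip d N r" "d ^ N"] assms flip_less by simp
  fix i assume i: "i < Suc N"
  show "digit d (Suc N) (flip d (Suc N) (k * d ^ N + r)) i =
        digit d (Suc N) (swap_ends d k * d ^ N + flip d N r) i"
    using i assms
    by (cases i) (simp_all add: digit_flip digit_block_0 digit_block_Suc flip_less)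
qed (rule flip_less)

lemma digit_flip_agree:
  "i < L \<Longrightarrow> digit d L (flip d L r) i = digit d L (flip d L s) i \<longleftrightarrow> digit d L r i = digit d L s i"
  by (simp add: digit_flip swap_ends_eq_iff digit_less d_pos)

end

section \<open>Matrices invariant up to weights\<close>

text \<open>If \<open>P\<^sub>f\<close> is the monomial matrix with entries \<open>f i\<close> at \<open>(\<pi> i, i)\<close>, this
  says \<open>P\<^sub>f X = X P\<^sub>h\<close>.\<close>

definition intertwines ::
  "nat \<Rightarrow> (nat \<Rightarrow> nat) \<Rightarrow> (nat \<Rightarrow> complex) \<Rightarrow> (nat \<Rightarrow> complex) \<Rightarrow> complex mat \<Rightarrow> bool" where
  "intertwines m \<pi> f h X \<longleftrightarrow> X \<in> carrier_mat m m \<and>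
     (\<forall>i<m. \<forall>j<m. f i * X $$ (i, j) = X $$ (\<pi> i, \<pi> j) * h j)"

lemma intertwinesD:
  "intertwines m \<pi> f h X \<Longrightarrow> i < m \<Longrightarrow> j < m \<Longrightarrow> f i * X $$ (i, j) = X $$ (\<pi> i, \<pi> j) * h j"
  by (simp add: intertwines_def)

lemma index_mult_mat_sum:
  "A \<in> carrier_mat m m \<Longrightarrow> B \<in> carrier_mat m m \<Longrightarrow> i < m \<Longrightarrow> j < m \<Longrightarrow>
    (A * B) $$ (i, j) = (\<Sum>k<m. A $$ (i, k) * B $$ (k, j))"
  by (simp add: scalar_prod_def lessThan_atLeast0)

text \<open>In operator form \<open>P_f X Y = X P_h Y = X Y P_k\<close>. In entries the weight
  \<open>h\<close> passes from \<open>X\<close> to \<open>Y\<close>, and the inner summation index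
  is then relabelled by the bijection \<pi>.\<close>

lemma intertwines_mult:
  assumes \<pi>: "bij_betw \<pi> {..<m} {..<m}"
    and X: "intertwines m \<pi> f h X" and Y: "intertwines m \<pi> h k Y"
  shows "intertwines m \<pi> f k (X * Y)"
proof -
  have c: "X \<in> carrier_mat m m" "Y \<in> carrier_mat m m"
    using X Y by (auto simp: intertwines_def)
  have \<pi>m: "\<pi> i < m" if "i < m" for i
    using bij_betwE[OF \<pi>] that by auto
  have "f i * (X * Y) $$ (i, j) = (X * Y) $$ (\<pi> i, \<pi> j) * k j" if ij: "i < m" "j < m" for i j
  proof -
    have "f i * (X * Y) $$ (i, j) = (\<Sum>l<m. (f i * X $$ (i, l)) * Y $$ (l, j))"
      by (simp add: index_mult_mat_sum[OF c ij] sum_distrib_left mult.assoc del: index_mult_mat)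
    also have "\<dots> = (\<Sum>l<m. X $$ (\<pi> i, \<pi> l) * (h l * Y $$ (l, j)))"
      by (rule sum.cong) (use intertwinesD[OF X ij(1)] in \<open>simp_all add: mult.assoc\<close>)
    also have "\<dots> = (\<Sum>l<m. X $$ (\<pi> i, \<pi> l) * Y $$ (\<pi> l, \<pi> j) * k j)"
      by (rule sum.cong) (use intertwinesD[OF Y _ ij(2)] in \<open>simp_all add: mult.assoc\<close>)
    also have "\<dots> = (\<Sum>l<m. X $$ (\<pi> i, l) * Y $$ (l, \<pi> j) * k j)"
      by (rule sum.reindex_bij_betw[OF \<pi>])
    also have "\<dots> = (X * Y) $$ (\<pi> i, \<pi> j) * k j"
      by (simp add: index_mult_mat_sum[OF c \<pi>m[OF ij(1)] \<pi>m[OF ij(2)]] sum_distrib_right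
          del: index_mult_mat)
    finally show ?thesis .
  qed
  with c show ?thesis by (auto simp: intertwines_def)
qed

lemma intertwines_mat_prod:
  assumes \<pi>: "bij_betw \<pi> {..<m} {..<m}"
    and "\<And>X. X \<in> set Xs \<Longrightarrow> intertwines m \<pi> f f X"
  shows "intertwines m \<pi> f f (mat_prod m Xs)"
  using assms(2)
proof (induction Xs)
  case Nil
  \<comment> \<open>The empty product is the identity matrix; its Kronecker delta is preserved
    because \<pi> is injective.\<close>
  have "\<pi> i < m" "\<pi> i = \<pi> j \<longleftrightarrow> i = j" if "i < m" "j < m" for i j
    using bij_betwE[OF \<pi>] bij_betw_imp_inj_on[OF \<pi>] that by (auto dest: inj_onD)
  then show ?case by (auto simp: mat_prod_def intertwines_def)
next
  case (Cons X Xs)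
  then show ?case
    using intertwines_mult[OF \<pi>, of f f X f "mat_prod m Xs"] by (simp add: mat_prod_def)
qed

section \<open>Passage to tensor factors and to the partial trace\<close>

lemma flip_bij:
  assumes "d > 0"
  shows "bij_betw (flip d L) {..<d ^ L} {..<d ^ L}"
  by (rule bij_betw_byWitness[where f' = "flip d L"]) (auto simp: flip_flip flip_less assms)

text \<open>The swap is injective on each digit, so two indices agree on the untouched factors
  exactly when their flips do. Only digit 0 carries weights.\<close>

lemma intertwines_op1:
  assumes "L > 0" and A: "intertwines d (swap_ends d) f h A" and d: "d > 0"
  shows "intertwines (d ^ L) (flip d L) (\<lambda>r. f (digit d L r 0)) (\<lambda>s. h (digit d L s 0))
           (op1 d L 0 A)"
proof -
  have "(\<forall>k<L. k \<noteq> 0 \<longrightarrow> digit d L (flip d L r) k = digit d L (flip d L s) k)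
      \<longleftrightarrow> (\<forall>k<L. k \<noteq> 0 \<longrightarrow> digit d L r k = digit d L s k)" for r s
    using digit_flip_agree[OF d] by auto
  then show ?thesis
    using intertwinesD[OF A digit_less[OF d] digit_less[OF d]] \<open>L > 0\<close>
    by (auto simp: intertwines_def op1_def flip_less[OF d] digit_flip[OF d])
qed

text \<open>The argument for one factor, with two active digits. The order of \<open>i\<close> and
  \<open>j\<close> is free, so the factors of \<open>mono_T\<close> and of \<open>mono_That\<close>
  are both covered.\<close>

lemma intertwines_op2:
  assumes ij: "i < L" "j < L" and d: "d > 0"
    and A: "\<And>a b a' b'. a < d \<Longrightarrow> b < d \<Longrightarrow> a' < d \<Longrightarrow> b' < d \<Longrightarrow>
      f a b * A $$ (a * d + b, a' * d + b')
        = A $$ (swap_ends d a * d + swap_ends d b, swap_ends d a' * d + swap_ends d b') * f a' b'"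
  defines "F \<equiv> \<lambda>r. f (digit d L r i) (digit d L r j)"
  shows "intertwines (d ^ L) (flip d L) F F (op2 d L i j A)"
proof -
  have "(\<forall>k<L. k \<noteq> i \<and> k \<noteq> j \<longrightarrow> digit d L (flip d L r) k = digit d L (flip d L s) k)
      \<longleftrightarrow> (\<forall>k<L. k \<noteq> i \<and> k \<noteq> j \<longrightarrow> digit d L r k = digit d L s k)" for r s
    using digit_flip_agree[OF d] by auto
  then show ?thesis
    using A[OF digit_less[OF d] digit_less[OF d] digit_less[OF d] digit_less[OF d]] ij
    by (auto simp: F_def intertwines_def op2_def flip_less[OF d] digit_flip[OF d])
qed

text \<open>Only blocks with equal auxiliary label \<open>k\<close> enter the trace. There the left
  and right weights are the same nonzero number \<open>f k\<close> and cancel; swapping the ends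
  merely permutes the summands.\<close>

lemma ptrace0_flip:
  assumes X: "intertwines (d ^ Suc N) (flip d (Suc N))
      (\<lambda>r. f (digit d (Suc N) r 0)) (\<lambda>r. f (digit d (Suc N) r 0)) X"
    and f: "\<And>k. k < d \<Longrightarrow> f k \<noteq> 0" and d: "d > 0" and rs: "r < d ^ N" "s < d ^ N"
  shows "ptrace0 d N X $$ (flip d N r, flip d N s) = ptrace0 d N X $$ (r, s)"
proof -
  have bij: "bij_betw (swap_ends d) {..<d} {..<d}"
    by (rule bij_betw_byWitness[where f' = "swap_ends d"]) auto
  have step: "X $$ (k * d ^ N + r, k * d ^ N + s)
      = X $$ (swap_ends d k * d ^ N + flip d N r, swap_ends d k * d ^ N + flip d N s)"
    if k: "k < d" for k
    using intertwinesD[OF X, of "k * d ^ N + r" "k * d ^ N + s"] f[OF k]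
    by (simp add: flip_block[OF d] digit_block_0 k rs block_less)
  have "ptrace0 d N X $$ (r, s) = (\<Sum>k<d. X $$ (k * d ^ N + r, k * d ^ N + s))"
    using rs by (simp add: ptrace0_def)
  also have "\<dots> = (\<Sum>k<d. X $$ (swap_ends d k * d ^ N + flip d N r,
                                   swap_ends d k * d ^ N + flip d N s))"
    by (rule sum.cong) (auto intro: step)
  also have "\<dots> = (\<Sum>k<d. X $$ (k * d ^ N + flip d N r, k * d ^ N + flip d N s))"
    by (rule sum.reindex_bij_betw[OF bij])
  also have "\<dots> = ptrace0 d N X $$ (flip d N r, flip d N s)"
    by (simp add: ptrace0_def flip_less[OF d])
  finally show ?thesis by simp
qed

section \<open>The symmetry operator as a permutation matrix\<close>

text \<open>The 1 of row \<open>i\<close> sits in column \<open>f i\<close>: left multiplication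
  relabels rows by \<open>f\<close>, and products compose in reverse order.\<close>

definition fun_mat :: "nat \<Rightarrow> (nat \<Rightarrow> nat) \<Rightarrow> complex mat" where
  "fun_mat m f = mat m m (\<lambda>(i, j). if j = f i then 1 else 0)"

lemma fun_mat_carrier [simp]: "fun_mat m f \<in> carrier_mat m m"
  by (simp add: fun_mat_def)

lemma fun_mat_mult_index:
  assumes "X \<in> carrier_mat m m" "f i < m" "i < m" "j < m"
  shows "(fun_mat m f * X) $$ (i, j) = X $$ (f i, j)"
proof -
  have "(fun_mat m f * X) $$ (i, j) = (\<Sum>k<m. (if k = f i then 1 else 0) * X $$ (k, j))"
    using index_mult_mat_sum[OF fun_mat_carrier assms(1,3,4), of f] assms(3)
    by (simp add: fun_mat_def)
  then show ?thesis using assms by (simp add: if_distrib[of "\<lambda>c. c * _"] cong: if_cong)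
qed

lemma fun_mat_mult:
  assumes "\<And>i. i < m \<Longrightarrow> f i < m"
  shows "fun_mat m f * fun_mat m h = fun_mat m (\<lambda>i. h (f i))"
proof (rule eq_matI)
  fix i j assume ij: "i < dim_row (fun_mat m (\<lambda>i. h (f i)))" "j < dim_col (fun_mat m (\<lambda>i. h (f i)))"
  then have "i < m" "j < m" by (auto simp: fun_mat_def)
  then show "(fun_mat m f * fun_mat m h) $$ (i, j) = fun_mat m (\<lambda>i. h (f i)) $$ (i, j)"
    using fun_mat_mult_index[of "fun_mat m h" m f i j] assms by (simp add: fun_mat_def)
qed (simp_all add: fun_mat_def)

text \<open>Digits determine an index, so agreement off factor \<open>k\<close> together with a
  swapped digit at \<open>k\<close> amounts to a single equation between indices.\<close>

lemma op1_Zr: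
  assumes "k < L" and d: "d \<ge> 2"
  shows "op1 d L k (Zr d) = fun_mat (d ^ L) (digit_map d L (\<lambda>i. if i = k then swap_ends d else id))"
    (is "_ = fun_mat _ ?h")
proof (rule eq_matI)
  have d0: "d > 0" using d by simp
  fix r s assume "r < dim_row (fun_mat (d ^ L) ?h)" "s < dim_col (fun_mat (d ^ L) ?h)"
  then have rs: "r < d ^ L" "s < d ^ L" by (auto simp: fun_mat_def)
  have dig: "digit d L (?h r) i = (if i = k then swap_ends d else id) (digit d L r i)"
    if "i < L" for i
    by (rule digit_digit_map) (use that d0 in auto)
  have h: "?h r < d ^ L" by (rule digit_map_less) (use d0 in auto)
  have "s = ?h r \<longleftrightarrow> (\<forall>i<L. digit d L s i = digit d L (?h r) i)"
    using digit_eqI[OF rs(2) h] by auto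
  also have "\<dots> \<longleftrightarrow> (\<forall>i<L. i \<noteq> k \<longrightarrow> digit d L r i = digit d L s i) \<and>
      digit d L s k = swap_ends d (digit d L r k)"
    using assms(1) by (auto simp: dig)
  finally have iff: "s = ?h r \<longleftrightarrow> \<dots>" .
  have "Zr d $$ (a, b) = (if b = swap_ends d a then 1 else 0)" if "a < d" "b < d" for a b
    using that d by (auto simp: Zr_def swap_ends_def)
  then show "op1 d L k (Zr d) $$ (r, s) = fun_mat (d ^ L) ?h $$ (r, s)"
    using rs by (auto simp: op1_def fun_mat_def iff digit_less d0)
qed (simp_all add: op1_def fun_mat_def)

text \<open>Final segments of sites are used because \<open>mat_prod\<close> is a right fold:
  lengthening the segment by one multiplies by a new factor on the left. The case
  \<open>k = L\<close> is the full product.\<close>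

lemma mat_prod_op1_Zr:
  assumes d: "d \<ge> 2"
  shows "k \<le> L \<Longrightarrow> mat_prod (d ^ L) (map (\<lambda>k. op1 d L k (Zr d)) [L - k..<L])
    = fun_mat (d ^ L) (digit_map d L (\<lambda>i. if L - k \<le> i then swap_ends d else id))"
proof (induction k)
  case 0
  have d0: "d > 0" using d by simp
  have "digit_map d L (\<lambda>i. if L \<le> i then swap_ends d else id) r = r" if "r < d ^ L" for r
    by (rule digit_eqI, rule digit_map_less)
      (use d0 that in \<open>auto simp: digit_digit_map\<close>)
  then show ?case by (auto simp: mat_prod_def fun_mat_def)
next
  case (Suc k)
  have d0: "d > 0" using d by simp
  define l where "l = L - Suc k"
  have l: "l < L" "L - k = Suc l" using Suc.prems by (auto simp: l_def)
  let ?one = "digit_map d L (\<lambda>i. if i = l then swap_ends d else id)"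
  let ?up = "\<lambda>l. digit_map d L (\<lambda>i. if l \<le> i then swap_ends d else id)"
  have "?up (Suc l) (?one r) = ?up l r" if "r < d ^ L" for r
  proof (rule digit_eqI)
    show "?up (Suc l) (?one r) < d ^ L" "?up l r < d ^ L"
      by (rule digit_map_less; use d0 in auto)+
    show "digit d L (?up (Suc l) (?one r)) i = digit d L (?up l r) i" if "i < L" for i
      using that d0 by (auto simp: digit_digit_map digit_less)
  qed
  then have eq: "fun_mat (d ^ L) (\<lambda>r. ?up (Suc l) (?one r)) = fun_mat (d ^ L) (?up l)"
    by (auto simp: fun_mat_def)
  have "[l..<L] = l # [Suc l..<L]" using l by (simp add: upt_conv_Cons)
  then have "mat_prod (d ^ L) (map (\<lambda>k. op1 d L k (Zr d)) [l..<L])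
      = fun_mat (d ^ L) ?one * fun_mat (d ^ L) (?up (Suc l))"
    using Suc.IH Suc.prems op1_Zr[OF l(1) d] by (simp add: mat_prod_def l(2))
  also have "\<dots> = fun_mat (d ^ L) (\<lambda>r. ?up (Suc l) (?one r))"
    by (rule fun_mat_mult, rule digit_map_less) (use d0 in auto)
  finally show ?case by (simp only: eq flip: l_def)
qed

lemma Zr_all_eq: "d \<ge> 2 \<Longrightarrow> Zr_all d N = fun_mat (d ^ N) (flip d N)"
  using mat_prod_op1_Zr[of d N N] by (simp add: Zr_all_def flip_def)

lemma flip_commutes:
  assumes d: "d > 0" and X: "X \<in> carrier_mat (d ^ N) (d ^ N)"
    and inv: "\<And>r s. r < d ^ N \<Longrightarrow> s < d ^ N \<Longrightarrow> X $$ (flip d N r, flip d N s) = X $$ (r, s)"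
  shows "fun_mat (d ^ N) (flip d N) * X = X * fun_mat (d ^ N) (flip d N)"
proof (rule eq_matI)
  let ?P = "fun_mat (d ^ N) (flip d N)"
  fix r s assume "r < dim_row (X * ?P)" "s < dim_col (X * ?P)"
  then have rs: "r < d ^ N" "s < d ^ N" using X by (auto simp: fun_mat_def)
  \<comment> \<open>As \<open>flip\<close> is an involution, column \<open>s\<close> of
    \<open>?P\<close> has its 1 in row \<open>flip d N s\<close>.\<close>
  have flip_eq: "s = flip d N k \<longleftrightarrow> k = flip d N s" if "k < d ^ N" for k
    using flip_flip[OF d] that rs by auto
  have "(X * ?P) $$ (r, s) = (\<Sum>k<d ^ N. X $$ (r, k) * (if k = flip d N s then 1 else 0))"
    unfolding index_mult_mat_sum[OF X fun_mat_carrier rs]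
    by (rule sum.cong) (auto simp: fun_mat_def rs flip_eq)
  also have "\<dots> = X $$ (r, flip d N s)"
    using flip_less[OF d] by (simp add: if_distrib[of "\<lambda>c. _ * c"] cong: if_cong)
  also have "\<dots> = X $$ (flip d N r, s)"
    using inv[of "flip d N r" s] rs flip_less[OF d] by (simp add: flip_flip[OF d])
  also have "\<dots> = (?P * X) $$ (r, s)"
    using fun_mat_mult_index[OF X] flip_less[OF d] rs by simp
  finally show "(?P * X) $$ (r, s) = (X * ?P) $$ (r, s)" by simp
qed (use X in \<open>auto simp: fun_mat_def\<close>)

section \<open>Entries of the R-matrix\<close>

lemma sum_single:
  assumes "finite S" "\<And>x. x \<in> S \<Longrightarrow> x \<noteq> a \<Longrightarrow> F x = (0::complex)"
  shows "sum F S = (if a \<in> S then F a else 0)"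
proof -
  have "sum F S = sum (\<lambda>x. if x = a then F x else 0) S"
    by (rule sum.cong) (auto simp: assms(2))
  then show ?thesis using assms(1) by simp
qed

lemma kron_elem_index:
  assumes "i < d" "j < d" "k < d" "l < d"
  shows "(elem_mat d \<alpha> \<beta> \<otimes>\<^sub>k elem_mat d \<gamma> \<delta>) $$ (i * d + j, k * d + l)
    = (if \<alpha> = Suc i \<and> \<beta> = Suc k \<and> \<gamma> = Suc j \<and> \<delta> = Suc l then 1 else 0)"
  using assms block_less[of i d j d] block_less[of k d l d]
  by (auto simp: kron_def elem_mat_def)

lemma mat_sum_dims [simp]: "dim_row (mat_sum m F S) = m" "dim_col (mat_sum m F S) = m"
  by (simp_all add: mat_sum_def)

lemma mat_sum_index: "i < m \<Longrightarrow> j < m \<Longrightarrow> mat_sum m F S $$ (i, j) = (\<Sum>x\<in>S. F x $$ (i, j))"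
  by (simp add: mat_sum_def)

text \<open>Each sum in \<open>R_mat\<close> has at most one term contributing to a given entry.
  With labels counted from 0, conjugation \<alpha>' = d + 1 - \<alpha> becomes \<open>i\<close> to
  \<open>d - 1 - i\<close>.\<close>

lemma R_mat_index:
  fixes g n defines "d \<equiv> dimV g n"
  assumes ijkl: "i < d" "j < d" "k < d" "l < d"
  shows "R_mat g n \<eta> u $$ (i * d + j, k * d + l) =
      (if i = j \<and> k = i \<and> l = i \<and> i \<noteq> d - 1 - i then c_coeff g n \<eta> u else 0)
    + (if k = i \<and> l = j \<and> i \<noteq> j \<and> i \<noteq> d - 1 - j then b_coeff g n \<eta> u else 0)
    + (if k = j \<and> l = i \<and> i \<noteq> j \<and> i \<noteq> d - 1 - j
       then if i < j then e_coeff g n \<eta> u else ebar_coeff g n \<eta> u else 0)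
    + (if j = d - 1 - i \<and> l = d - 1 - k then a_coeff g n \<eta> (Suc i) (Suc k) u else 0)"
proof -
  let ?r = "i * d + j" and ?s = "k * d + l"
  have rs: "?r < d * d" "?s < d * d" using ijkl by (auto intro: block_less)
  have cj: "conj_ix d (Suc a) = d - a" for a by (simp add: conj_ix_def)
  have sumC: "(\<Sum>\<alpha>\<in>{\<alpha> \<in> {1..d}. \<alpha> \<noteq> conj_ix d \<alpha>}.
        (elem_mat d \<alpha> \<alpha> \<otimes>\<^sub>k elem_mat d \<alpha> \<alpha>) $$ (?r, ?s))
      = (if i = j \<and> k = i \<and> l = i \<and> i \<noteq> d - 1 - i then 1 else 0)"
    by (subst sum_single[where a = "Suc i"]) (use ijkl in \<open>auto simp: kron_elem_index cj split: if_splits\<close>)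
  have sumB: "(\<Sum>x\<in>{(\<alpha>, \<beta>) \<in> {1..d} \<times> {1..d}. \<alpha> \<noteq> \<beta> \<and> \<alpha> \<noteq> conj_ix d \<beta>}.
        (case x of (\<alpha>, \<beta>) \<Rightarrow> elem_mat d \<alpha> \<alpha> \<otimes>\<^sub>k elem_mat d \<beta> \<beta>) $$ (?r, ?s))
      = (if k = i \<and> l = j \<and> i \<noteq> j \<and> i \<noteq> d - 1 - j then 1 else 0)"
    by (subst sum_single[where a = "(Suc i, Suc j)"],
        rule finite_subset[of _ "{1..d} \<times> {1..d}"])
      (use ijkl in \<open>auto simp: kron_elem_index cj split: if_splits\<close>)
  have sumE: "(\<Sum>x\<in>{(\<alpha>, \<beta>) \<in> {1..d} \<times> {1..d}. \<alpha> < \<beta> \<and> \<alpha> \<noteq> conj_ix d \<beta>}.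
        (case x of (\<alpha>, \<beta>) \<Rightarrow> elem_mat d \<alpha> \<beta> \<otimes>\<^sub>k elem_mat d \<beta> \<alpha>) $$ (?r, ?s))
      = (if k = j \<and> l = i \<and> i < j \<and> i \<noteq> d - 1 - j then 1 else 0)"
    by (subst sum_single[where a = "(Suc i, Suc j)"],
        rule finite_subset[of _ "{1..d} \<times> {1..d}"])
      (use ijkl in \<open>auto simp: kron_elem_index cj split: if_splits\<close>)
  have sumEb: "(\<Sum>x\<in>{(\<alpha>, \<beta>) \<in> {1..d} \<times> {1..d}. \<beta> < \<alpha> \<and> \<alpha> \<noteq> conj_ix d \<beta>}.
        (case x of (\<alpha>, \<beta>) \<Rightarrow> elem_mat d \<alpha> \<beta> \<otimes>\<^sub>k elem_mat d \<beta> \<alpha>) $$ (?r, ?s))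
      = (if k = j \<and> l = i \<and> j < i \<and> i \<noteq> d - 1 - j then 1 else 0)"
    by (subst sum_single[where a = "(Suc i, Suc j)"],
        rule finite_subset[of _ "{1..d} \<times> {1..d}"])
      (use ijkl in \<open>auto simp: kron_elem_index cj split: if_splits\<close>)
  have single: "(a \<cdot>\<^sub>m (elem_mat d \<alpha> \<beta> \<otimes>\<^sub>k elem_mat d \<gamma> \<delta>)) $$ (?r, ?s)
      = (if \<alpha> = Suc i \<and> \<beta> = Suc k \<and> \<gamma> = Suc j \<and> \<delta> = Suc l then a else 0)" for a \<alpha> \<beta> \<gamma> \<delta>
  proof -
    have "dim_row (elem_mat d \<alpha> \<beta> \<otimes>\<^sub>k elem_mat d \<gamma> \<delta>) = d * d"
      "dim_col (elem_mat d \<alpha> \<beta> \<otimes>\<^sub>k elem_mat d \<gamma> \<delta>) = d * d"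
      by (simp_all add: kron_def elem_mat_def)
    then show ?thesis using rs by (simp add: kron_elem_index[OF ijkl])
  qed
  have sumA: "(\<Sum>x\<in>{1..d} \<times> {1..d}.
        (case x of (\<alpha>, \<beta>) \<Rightarrow> a_coeff g n \<eta> \<alpha> \<beta> u \<cdot>\<^sub>m
          (elem_mat d \<alpha> \<beta> \<otimes>\<^sub>k elem_mat d (conj_ix d \<alpha>) (conj_ix d \<beta>))) $$ (?r, ?s))
      = (if j = d - 1 - i \<and> l = d - 1 - k then a_coeff g n \<eta> (Suc i) (Suc k) u else 0)"
    unfolding split_beta single
    by (subst sum_single[where a = "(Suc i, Suc k)"])
      (use ijkl in \<open>auto simp: cj split: if_splits\<close>)
  show ?thesis
    unfolding R_mat_def Let_def d_def[symmetric]
    by (simp only: index_add_mat index_smult_mat mat_sum_dims mat_sum_index[OF rs] rs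
        sumC sumB sumE sumEb sumA) auto
qed

section \<open>Weights of the gauge-transformed swap\<close>

text \<open>The diagonal of \<open>B(u)\<close>; with entries \<open>wgt d u i\<close> at
  \<open>(swap_ends d i, i)\<close> the monomial matrix is \<open>W(u)\<close>.\<close>

definition wgt :: "nat \<Rightarrow> complex \<Rightarrow> nat \<Rightarrow> complex" where
  "wgt d u i = (if i = 0 then exp u else if i = d - 1 then exp (- u) else 1)"

lemma wgt_nonzero [simp]: "wgt d u i \<noteq> 0"
  by (simp add: wgt_def)

lemma wgt_uminus: "d \<ge> 2 \<Longrightarrow> wgt d (- u) i = inverse (wgt d u i)"
  by (simp add: wgt_def exp_minus)

text \<open>Conjugate labels carry opposite charges; this gives charge conservation for the
  \<open>a_coeff\<close> terms of \<open>R_mat\<close>.\<close>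

lemma wgt_conj: "d \<ge> 2 \<Longrightarrow> i < d \<Longrightarrow> wgt d u i * wgt d u (d - 1 - i) = 1"
  by (auto simp: wgt_def exp_minus)

lemma swap_ends_conj: "i < d \<Longrightarrow> swap_ends d (d - 1 - i) = d - 1 - swap_ends d i"
  by (auto simp: swap_ends_def)

lemma dimV_ge_2: "n \<ge> 1 \<Longrightarrow> dimV g n \<ge> 2"
  by (cases g) (auto simp: dimV_def)

text \<open>The sign \<open>sig\<close> switches between sinh and cosh, so the three types can be
  computed with uniformly.\<close>

lemma hfun_exp: "hfun g x = (exp x - sig g * exp (- x)) / 2"
  by (cases g) (simp_all add: hfun_def sig_def sinh_field_def cosh_field_def)

text \<open>This shift matches the exponents \<kappa> and -\<kappa> in the two triangular cases of
  \<open>a_coeff\<close>, and fixes the ratio of the end entries of \<open>M_mat\<close>.\<close>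

lemma bar_last: "n \<ge> 1 \<Longrightarrow> bar g n (dimV g n) = bar g n 1 + kap g n"
  by (cases g) (auto simp: bar_def dimV_def kap_def)

lemma eps_ends:
  "n \<ge> 1 \<Longrightarrow> eps g n 1 = 1" "n \<ge> 1 \<Longrightarrow> eps g n (dimV g n) = sig g" "sig g * sig g = 1"
  by (cases g; simp add: eps_def dimV_def sig_def)+

lemma exp_half_square: "exp (u / 2) * exp (u / 2) = exp (u :: complex)"
  by (simp flip: exp_add)

text \<open>The two ends are conjugate, so at most one of \<open>i\<close>, \<open>j\<close> is an
  end. The swap reverses their order exactly in that case, and the ratio \<open>exp u\<close> of the
  two coefficients makes up for the weights.\<close>

lemma offdiag_wgt:
  fixes g n \<eta> u defines "d \<equiv> dimV g n"
    and "F \<equiv> \<lambda>i j :: nat. if i < j then e_coeff g n \<eta> u else ebar_coeff g n \<eta> u"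
  assumes "n \<ge> 1" "i < d" "j < d" "i \<noteq> j" "i \<noteq> d - 1 - j"
  shows "wgt d u i * F i j = F (swap_ends d i) (swap_ends d j) * wgt d u j"
  using assms(3-) dimV_ge_2[of n g]
  by (auto simp: F_def d_def[symmetric] wgt_def swap_ends_def ebar_coeff_def exp_minus)

text \<open>With exactly one end label the \<delta> term vanishes, and \<open>bar_last\<close> and
  \<open>eps_ends\<close> leave only the ratio of \<open>exp (u/2)\<close> and
  \<open>exp (- u/2)\<close>. The \<delta> term matters only for two opposite ends, treated in
  \<open>corner\<close>.\<close>

lemma a_coeff_wgt:
  fixes g n \<eta> u defines "d \<equiv> dimV g n"
  assumes n: "n \<ge> 1" and ik: "i < d" "k < d"
  shows "wgt d u i * a_coeff g n \<eta> (Suc i) (Suc k) u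
    = a_coeff g n \<eta> (Suc (swap_ends d i)) (Suc (swap_ends d k)) u * wgt d u k"
proof -
  have d2: "d \<ge> 2" using dimV_ge_2[OF n] by (simp add: d_def)
  have d1: "Suc (d - Suc 0) = d" using d2 by simp
  note ends = bar_last[OF n, of g, folded d_def, unfolded One_nat_def]
    eps_ends(1,2)[OF n, of g, folded d_def, unfolded One_nat_def]
  define x where "x = exp (u / 2)"
  have x0: "x \<noteq> 0" by (simp add: x_def)
  have x: "exp (- u / 2) = inverse x" "exp (- (u / 2)) = inverse x" "exp u = x * x"
    "exp (- u) = inverse x * inverse x"
    by (simp_all add: x_def exp_minus flip: exp_half_square[of u])
  have row: "a_coeff g n \<eta> 1 (Suc k) u = inverse x * inverse x * a_coeff g n \<eta> d (Suc k) u"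
    if "0 < k" "k < d - 1" for k
  proof -
    have "d \<noteq> d - k" "d - k \<noteq> d" "Suc 0 \<noteq> d - k" "\<not> d < Suc k" "d \<noteq> Suc k" "Suc k < d"
      using that by linarith+
    then show ?thesis
      using that d2 x0 unfolding a_coeff_def Let_def d_def[symmetric]
      by (simp add: conj_ix_def x ends algebra_simps flip: x_def)
  qed
  \<comment> \<open>The prefactor \<open>sig g\<close> of the case \<alpha> < \<beta> meets
    \<open>eps g n d = sig g\<close>, and the product is 1.\<close>
  have col: "a_coeff g n \<eta> (Suc i) d u = inverse x * inverse x * a_coeff g n \<eta> (Suc i) 1 u"
    if "0 < i" "i < d - 1" for i
  proof -
    have "d \<noteq> d - i" "d - i \<noteq> d" "Suc 0 \<noteq> d - i" "\<not> d < Suc i" "d \<noteq> Suc i" "Suc i < d"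
      using that by linarith+
    then show ?thesis
      using that d2 x0 unfolding a_coeff_def Let_def d_def[symmetric]
      by (simp add: conj_ix_def x ends algebra_simps flip: x_def) (simp add: eps_ends(3))
  qed
  \<comment> \<open>With \<open>x = exp (u/2)\<close> and \<open>q = exp (kap g n * \<eta>)\<close>,
    the \<open>x / q\<close> terms cancel on the left and the \<open>q / x\<close> terms on the
    right; both sides become \<open>sinh (2 * \<eta>) * (sig g * q - 1 / q)\<close>.\<close>
  have corner: "x * x * a_coeff g n \<eta> 1 d u = a_coeff g n \<eta> d 1 u * (inverse x * inverse x)"
  proof -
    define q where "q = exp (kap g n * \<eta>)"
    have q0: "q \<noteq> 0" by (simp add: q_def)
    have h: "hfun g (u / 2 - kap g n * \<eta>) = (x / q - sig g * (q / x)) / 2"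
      by (simp add: hfun_exp exp_diff x_def q_def)
    have s: "sinh (u / 2) = (x - inverse x) / 2"
      by (simp add: sinh_field_def x_def exp_minus)
    have sg: "sig g * (sig g * z) = z" for z
      using eps_ends(3)[of g] by (simp add: mult.assoc[symmetric])
    have e1: "exp ((kap g n + 2 * (bar g n 1 - bar g n d)) * \<eta>) = inverse q"
      by (simp add: ends q_def algebra_simps flip: exp_minus)
    have e2: "exp ((- kap g n + 2 * (bar g n d - bar g n 1)) * \<eta>) = q"
      by (simp add: ends q_def algebra_simps)
    have A: "a_coeff g n \<eta> 1 d u = 2 * sinh (2 * \<eta>) * inverse x *
        (inverse q * ((x - inverse x) / 2) - (x / q - sig g * (q / x)) / 2)"
      using d2 unfolding a_coeff_def Let_def d_def[symmetric] h e1
      by (simp add: conj_ix_def x ends sg s eps_ends(3))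
    have B: "a_coeff g n \<eta> d 1 u = 2 * sinh (2 * \<eta>) * x *
        (sig g * q * ((x - inverse x) / 2) - (x / q - sig g * (q / x)) / 2)"
      using d2 unfolding a_coeff_def Let_def d_def[symmetric] h e2
      by (simp add: conj_ix_def ends s flip: x_def)
    show ?thesis
      unfolding A B using x0 q0 by (simp add: field_simps)
  qed
  have diag: "a_coeff g n \<eta> 1 1 u = a_coeff g n \<eta> d d u"
    using d2 unfolding a_coeff_def Let_def d_def[symmetric] by (simp add: conj_ix_def)
  consider "i = 0" | "i = d - 1" | "0 < i" "i < d - 1" using ik by linarith
  then show ?thesis
  proof cases
    case 1
    consider "k = 0" | "k = d - 1" | "0 < k" "k < d - 1" using ik by linarith
    then show ?thesis
      using 1 d2 row[of k] corner diag x0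
      by cases (auto simp: wgt_def swap_ends_def x d1 field_simps)
  next
    case 2
    consider "k = 0" | "k = d - 1" | "0 < k" "k < d - 1" using ik by linarith
    then show ?thesis
      using 2 d2 row[of k] corner diag x0
      by cases (auto simp: wgt_def swap_ends_def x d1 field_simps)
  next
    case 3
    consider "k = 0" | "k = d - 1" | "0 < k" "k < d - 1" using ik by linarith
    then show ?thesis
      using 3 d2 col[of i] x0
      by cases (auto simp: wgt_def swap_ends_def x d1 field_simps)
  qed
qed

text \<open>The two commutation relations of \<open>R\<close> with \<open>W(u)\<close> on one leg.
  The first holds separately for each kind of coefficient; the second follows from it by charge
  conservation.\<close>

lemma R_mat_wgt:
  fixes g n \<eta> u defines "d \<equiv> dimV g n"
  defines "R \<equiv> \<lambda>i j k l. R_mat g n \<eta> u $$ (i * d + j, k * d + l)"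
    and "\<tau> \<equiv> swap_ends d"
  assumes n: "n \<ge> 1" and ijkl: "i < d" "j < d" "k < d" "l < d"
  shows "wgt d u i * R i j k l = R (\<tau> i) (\<tau> j) (\<tau> k) (\<tau> l) * wgt d u k"
    and "wgt d (- u) j * R i j k l = R (\<tau> i) (\<tau> j) (\<tau> k) (\<tau> l) * wgt d (- u) l"
proof -
  have d2: "d \<ge> 2" using dimV_ge_2[OF n] by (simp add: d_def)
  note idx = R_mat_index[of _ g n, folded d_def]
  have eq: "\<tau> a = \<tau> b \<longleftrightarrow> a = b" if "a < d" "b < d" for a b
    using that by (simp add: \<tau>_def swap_ends_eq_iff)
  have cj: "\<tau> a = d - 1 - \<tau> b \<longleftrightarrow> a = d - 1 - b" if "a < d" "b < d" for a b
    using that eq[of a "d - 1 - b"] swap_ends_conj[of b d] by (simp add: \<tau>_def)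
  have less: "\<tau> a < d" if "a < d" for a using that by (simp add: \<tau>_def)
  show first: "wgt d u i * R i j k l = R (\<tau> i) (\<tau> j) (\<tau> k) (\<tau> l) * wgt d u k"
  proof -
    let ?F = "\<lambda>i j :: nat. if i < j then e_coeff g n \<eta> u else ebar_coeff g n \<eta> u"
    \<comment> \<open>The swap respects equality and conjugation of labels, so all four support
      conditions stay the same.\<close>
    have "R (\<tau> i) (\<tau> j) (\<tau> k) (\<tau> l) * wgt d u k =
      (if i = j \<and> k = i \<and> l = i \<and> i \<noteq> d - 1 - i then c_coeff g n \<eta> u * wgt d u k else 0)
    + (if k = i \<and> l = j \<and> i \<noteq> j \<and> i \<noteq> d - 1 - j then b_coeff g n \<eta> u * wgt d u k else 0)
    + (if k = j \<and> l = i \<and> i \<noteq> j \<and> i \<noteq> d - 1 - j then ?F (\<tau> i) (\<tau> j) * wgt d u k else 0)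
    + (if j = d - 1 - i \<and> l = d - 1 - k
       then a_coeff g n \<eta> (Suc (\<tau> i)) (Suc (\<tau> k)) u * wgt d u k else 0)"
      unfolding R_def idx[OF less less less less, OF ijkl]
      by (simp only: eq cj ijkl distrib_right if_distrib[of "\<lambda>c. c * wgt d u k"] mult_zero_left
          cong: if_cong)
    also have "\<dots> =
      (if i = j \<and> k = i \<and> l = i \<and> i \<noteq> d - 1 - i then wgt d u i * c_coeff g n \<eta> u else 0)
    + (if k = i \<and> l = j \<and> i \<noteq> j \<and> i \<noteq> d - 1 - j then wgt d u i * b_coeff g n \<eta> u else 0)
    + (if k = j \<and> l = i \<and> i \<noteq> j \<and> i \<noteq> d - 1 - j then wgt d u i * ?F i j else 0)
    + (if j = d - 1 - i \<and> l = d - 1 - k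
       then wgt d u i * a_coeff g n \<eta> (Suc i) (Suc k) u else 0)"
      using offdiag_wgt[where g = g and n = n and \<eta> = \<eta> and u = u, folded d_def, OF n ijkl(1,2)]
        a_coeff_wgt[where g = g and n = n and \<eta> = \<eta> and u = u, folded d_def, OF n ijkl(1,3)]
      by (intro arg_cong2[where f = "(+)"] if_cong refl) (auto simp: \<tau>_def mult.commute)
    also have "\<dots> = wgt d u i * R i j k l"
      unfolding R_def idx[OF ijkl]
      by (simp only: distrib_left if_distrib[of "\<lambda>c. wgt d u i * c"] mult_zero_right cong: if_cong)
    finally show ?thesis by simp
  qed
  show "wgt d (- u) j * R i j k l = R (\<tau> i) (\<tau> j) (\<tau> k) (\<tau> l) * wgt d (- u) l"
  proof (cases "R i j k l = 0")
    case True
    \<comment> \<open>The weights are nonzero, so \<open>first\<close> makes the swapped entry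
      vanish as well.\<close>
    then show ?thesis using first by simp
  next
    case False
    \<comment> \<open>Charge conservation: a nonzero entry either has the same two labels in row and
      column, or conjugate pairs in both, of total weight 1.\<close>
    have "wgt d u i * wgt d u j = wgt d u k * wgt d u l"
      using False wgt_conj[OF d2 ijkl(1)] wgt_conj[OF d2 ijkl(3)]
      unfolding R_def idx[OF ijkl] by (auto split: if_splits simp: mult.commute)
    then have weight: "inverse (wgt d u j) = wgt d u i * inverse (wgt d u k * wgt d u l)"
      by (metis inverse_mult_distrib mult.assoc right_inverse mult.right_neutral wgt_nonzero
          mult.left_commute)
    have "wgt d (- u) j * R i j k l = wgt d u i * R i j k l * inverse (wgt d u k * wgt d u l)"
      by (simp add: wgt_uminus[OF d2] weight)
    also have "\<dots> = R (\<tau> i) (\<tau> j) (\<tau> k) (\<tau> l) * wgt d (- u) l"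
      unfolding first by (simp add: wgt_uminus[OF d2])
    finally show ?thesis .
  qed
qed

section \<open>The K-matrices and the transfer matrix\<close>

text \<open>By \<open>1 \<le> p\<close> and \<open>2 * p \<le> d\<close> the end entries are
  \<open>exp (- u)\<close> and \<open>exp u\<close>, which the weights balance; inner labels are
  fixed with weight 1.\<close>

lemma KR_wgt:
  fixes g n \<eta> \<gamma>0 u defines "d \<equiv> dimV g n"
  assumes "1 \<le> p" "p \<le> n"
  shows "intertwines d (swap_ends d) (wgt d u) (wgt d (- u)) (KR g n \<eta> \<gamma>0 p u)"
proof -
  have "2 * p \<le> d" using assms by (cases g) (auto simp: dimV_def)
  then show ?thesis
    using assms(2)
    by (auto simp: intertwines_def KR_def Let_def d_def[symmetric] wgt_def swap_ends_def exp_minus)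
qed

lemma M_mat_index:
  fixes g n defines "d \<equiv> dimV g n"
  assumes "i < d" "j < d"
  shows "M_mat g n \<eta> $$ (i, j) =
    (if i = j then sig g * exp (4 * ((of_nat d + 1) / 2 - bar g n (Suc i)) * \<eta>) else 0)"
proof -
  have "(\<Sum>\<alpha>\<in>{1..d}. (exp (4 * ((of_nat d + 1) / 2 - bar g n \<alpha>) * \<eta>) \<cdot>\<^sub>m elem_mat d \<alpha> \<alpha>) $$ (i, j))
      = (if i = j then exp (4 * ((of_nat d + 1) / 2 - bar g n (Suc i)) * \<eta>) else 0)"
    by (subst sum_single[where a = "Suc i"]) (use assms in \<open>auto simp: elem_mat_def\<close>)
  moreover have "(if g = A2 then - 1 else 1) = sig g"
    by (cases g) (simp_all add: sig_def)
  ultimately show ?thesis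
    using assms(2,3) by (simp add: M_mat_def Let_def d_def[symmetric] mat_sum_def)
qed

text \<open>The summand \<open>- \<i> * pi\<close> in the case \<open>A2\<close> produces the
  sign.\<close>

lemma exp_rho: "exp (rho g n \<eta>) = sig g * exp (- (2 * kap g n * \<eta>))"
  by (cases g) (simp_all add: rho_def sig_def exp_diff)

text \<open>As for \<open>KR\<close>, only the end entries matter. Their ratio involves
  \<open>exp (2 * rho g n \<eta>)\<close> from the crossed argument, which the ratio of the end
  entries of \<open>M_mat\<close> compensates.\<close>

lemma KL_wgt:
  fixes g n \<eta> \<gamma>0 u defines "d \<equiv> dimV g n"
  assumes p: "1 \<le> p" "p \<le> n"
  shows "intertwines d (swap_ends d) (wgt d (- u)) (wgt d u) (KL g n \<eta> \<gamma>0 p u)"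
proof -
  have pd: "2 * p \<le> d" using p by (cases g) (auto simp: dimV_def d_def)
  have n: "n \<ge> 1" using p by simp
  have d1: "Suc (d - Suc 0) = d" using pd p by simp
  have car: "KR g n \<eta> \<gamma>0 p v \<in> carrier_mat d d" "M_mat g n \<eta> \<in> carrier_mat d d" for v
    by (auto simp: KR_def M_mat_def Let_def d_def mat_sum_def)
  have KL: "KL g n \<eta> \<gamma>0 p u $$ (i, j) =
      (if i = j then KR g n \<eta> \<gamma>0 p (- u - rho g n \<eta>) $$ (i, i) * M_mat g n \<eta> $$ (i, i) else 0)"
    if "i < d" "j < d" for i j
  proof -
    have "KL g n \<eta> \<gamma>0 p u $$ (i, j) =
        (\<Sum>k<d. KR g n \<eta> \<gamma>0 p (- u - rho g n \<eta>) $$ (i, k) * M_mat g n \<eta> $$ (k, j))"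
      unfolding KL_def by (rule index_mult_mat_sum[OF car that])
    also have "\<dots> = (if i \<in> {..<d}
        then KR g n \<eta> \<gamma>0 p (- u - rho g n \<eta>) $$ (i, i) * M_mat g n \<eta> $$ (i, j) else 0)"
      by (rule sum_single) (use that in \<open>auto simp: KR_def Let_def d_def\<close>)
    finally show ?thesis
      using that by (simp add: M_mat_index[of _ g n, folded d_def])
  qed
  have first: "KL g n \<eta> \<gamma>0 p u $$ (0, 0) =
      exp (u + rho g n \<eta>) * M_mat g n \<eta> $$ (0, 0)"
    using p pd by (simp add: KL KR_def Let_def d_def[symmetric] add.commute)
  have last: "KL g n \<eta> \<gamma>0 p u $$ (d - 1, d - 1) =
      exp (- u - rho g n \<eta>) * M_mat g n \<eta> $$ (d - 1, d - 1)"
  proof -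
    have "\<not> d - 1 < d - p" "\<not> d - 1 < p" using p pd by linarith+
    then show ?thesis
      using p pd by (simp add: KL KR_def Let_def d_def[symmetric])
  qed
  have "exp (rho g n \<eta>) * exp (rho g n \<eta>) = exp (- (4 * kap g n * \<eta>))"
  proof -
    have "exp (rho g n \<eta>) * exp (rho g n \<eta>) =
        (sig g * sig g) * (exp (- (2 * kap g n * \<eta>)) * exp (- (2 * kap g n * \<eta>)))"
      by (simp add: exp_rho algebra_simps)
    then show ?thesis unfolding eps_ends(3) by (simp add: ac_simps flip: exp_add)
  qed
  \<comment> \<open>By \<open>bar_last\<close> the ratio of these entries is
    \<open>exp (- 4 * kap g n * \<eta>)\<close>, which is \<open>exp (2 * rho g n \<eta>)\<close>
    because the sign in \<open>exp_rho\<close> squares to 1.\<close>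
  then have "M_mat g n \<eta> $$ (d - 1, d - 1) =
      exp (rho g n \<eta>) * exp (rho g n \<eta>) * M_mat g n \<eta> $$ (0, 0)"
    using p pd bar_last[OF n, of g, folded d_def]
    by (simp add: M_mat_index[of _ g n, folded d_def] d1 algebra_simps flip: exp_add)
  then have ends: "exp (- u) * KL g n \<eta> \<gamma>0 p u $$ (0, 0) =
      exp u * KL g n \<eta> \<gamma>0 p u $$ (d - 1, d - 1)"
    by (simp add: first last[unfolded One_nat_def] exp_add exp_diff exp_minus)
  show ?thesis
    unfolding intertwines_def
  proof (intro conjI allI impI)
    show "KL g n \<eta> \<gamma>0 p u \<in> carrier_mat d d"
      unfolding KL_def by (rule mult_carrier_mat[OF car])
    fix i j assume ij: "i < d" "j < d"
    show "wgt d (- u) i * KL g n \<eta> \<gamma>0 p u $$ (i, j) =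
        KL g n \<eta> \<gamma>0 p u $$ (swap_ends d i, swap_ends d j) * wgt d u j"
    proof (cases "i = j")
      case True
      then show ?thesis
        using ends p pd by (auto simp: wgt_def swap_ends_def mult.commute)
    next
      case False
      then show ?thesis
        using ij KL[OF ij] KL[OF swap_ends_less swap_ends_less, OF ij]
        by (simp add: swap_ends_eq_iff)
    qed
  qed
qed

text \<open>Reading the product from left to right, the spectral argument of the auxiliary weight
  goes from \<open>- u\<close> to \<open>u\<close> across \<open>KL\<close>, stays across
  \<open>mono_T\<close>, returns to \<open>- u\<close> across \<open>KR\<close> and stays across
  \<open>mono_That\<close>. Equal weights at both ends permit taking the trace.\<close>

lemma transfer_flip:
  fixes g n \<eta> \<gamma>0 u N p defines "d \<equiv> dimV g n" and "t \<equiv> transfer g n \<eta> \<gamma>0 N p u"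
  assumes p: "1 \<le> p" "p \<le> n" and rs: "r < d ^ N" "s < d ^ N"
  shows "t $$ (flip d N r, flip d N s) = t $$ (r, s)"
proof -
  have n: "n \<ge> 1" using p by simp
  have d: "d > 0" using dimV_ge_2[OF n, of g] by (simp add: d_def)
  let ?L = "Suc N"
  let ?w = "\<lambda>u r. wgt d u (digit d ?L r 0)"
  let ?I = "intertwines (d ^ ?L) (flip d ?L)"
  note bij = flip_bij[OF d, of ?L]
  have "?I (?w (- u)) (?w u) (op1 d ?L 0 (KL g n \<eta> \<gamma>0 p u))"
    by (rule intertwines_op1[OF _ KL_wgt[OF p, of g, folded d_def] d]) simp
  moreover have "?I (?w u) (?w u) (op2 d ?L 0 k (R_mat g n \<eta> u))" if "k < ?L" for k
    by (rule intertwines_op2[where f = "\<lambda>a b. wgt d u a"])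
      (use that d R_mat_wgt(1)[where g = g and n = n, folded d_def, OF n] in simp_all)
  then have "?I (?w u) (?w u) (mono_T g n \<eta> N u)"
    unfolding mono_T_def Let_def d_def[symmetric] Suc_eq_plus1[symmetric]
    by (intro intertwines_mat_prod[OF bij]) auto
  moreover have "?I (?w u) (?w (- u)) (op1 d ?L 0 (KR g n \<eta> \<gamma>0 p u))"
    by (rule intertwines_op1[OF _ KR_wgt[OF p, of g, folded d_def] d]) simp
  \<comment> \<open>The auxiliary space is now the second leg of \<open>R_mat\<close>, hence the
    second relation of \<open>R_mat_wgt\<close>.\<close>
  moreover have "?I (?w (- u)) (?w (- u)) (op2 d ?L k 0 (R_mat g n \<eta> u))" if "k < ?L" for k
    by (rule intertwines_op2[where f = "\<lambda>a b. wgt d (- u) b"])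
      (use that d R_mat_wgt(2)[where g = g and n = n, folded d_def, OF n] in simp_all)
  then have "?I (?w (- u)) (?w (- u)) (mono_That g n \<eta> N u)"
    unfolding mono_That_def Let_def d_def[symmetric] Suc_eq_plus1[symmetric]
    by (intro intertwines_mat_prod[OF bij]) auto
  ultimately have "?I (?w (- u)) (?w (- u)) (op1 d ?L 0 (KL g n \<eta> \<gamma>0 p u) * mono_T g n \<eta> N u
      * op1 d ?L 0 (KR g n \<eta> \<gamma>0 p u) * mono_That g n \<eta> N u)"
    by (intro intertwines_mult[OF bij])
  from ptrace0_flip[OF this wgt_nonzero d rs] show ?thesis
    by (simp add: t_def transfer_def Let_def d_def)
qed

theorem proposition5:
  fixes g :: affine_type and n p N :: nat and \<eta> \<gamma>0 u :: complex
  assumes "n \<ge> 1" and "1 \<le> p" and "p \<le> n" and "N \<ge> 1"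
    and "\<gamma>0 \<in> {1, -1}"
    and "KR_defined g n \<eta> \<gamma>0 p u" and "KL_defined g n \<eta> \<gamma>0 p u"
  shows "commutator (Zr_all (dimV g n) N) (transfer g n \<eta> \<gamma>0 N p u)
           = 0\<^sub>m (dimV g n ^ N) (dimV g n ^ N)
       \<and> Zr_all (dimV g n) N * Zr_all (dimV g n) N = 1\<^sub>m (dimV g n ^ N)"
proof -
  define d where "d = dimV g n"
  let ?t = "transfer g n \<eta> \<gamma>0 N p u" and ?P = "fun_mat (d ^ N) (flip d N)"
  have d2: "d \<ge> 2" using dimV_ge_2[OF assms(1)] by (simp add: d_def)
  then have d: "d > 0" by simp
  have t: "?t \<in> carrier_mat (d ^ N) (d ^ N)"
    by (simp add: transfer_def Let_def ptrace0_def d_def)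
  have "?P * ?t = ?t * ?P"
    by (rule flip_commutes[OF d t]) (simp add: transfer_flip[OF assms(2,3), of _ g, folded d_def])
  then have "commutator ?P ?t = 0\<^sub>m (d ^ N) (d ^ N)"
    using minus_r_inv_mat[OF mult_carrier_mat[OF t fun_mat_carrier]] by (simp add: commutator_def)
  moreover have "?P * ?P = 1\<^sub>m (d ^ N)"
    using fun_mat_mult[of "d ^ N" "flip d N" "flip d N"] flip_less[OF d]
    by (auto simp: fun_mat_def flip_flip[OF d])
  ultimately show ?thesis
    using Zr_all_eq[OF d2] by (simp add: d_def)
qed

end
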